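(* Let $\mathbb K$ be a field and let $F\in\mathbb K\langle x,y\rangle$ be a cyclicly invariant polynomial (not necessarily homogeneous) having only terms of degree $5$ or higher. Then the potential algebra $A_F$ is infinite dimensional over $\mathbb K$.
   Context: $\mathbb K\langle x,y\rangle$ is the free associative unital algebra on $x,y$, with $\deg x=\deg y=1$. A polynomial $F\in\mathbb K\langle x,y\rangle$ is cyclicly invariant if it is fixed by the linear map sending each monomial $zu$ ($z\in\{x,y\}$, $u$ a monomial) to $uz$ and fixing constants. The linear maps $\partial_x,\partial_y:\mathbb K\langle x,y\rangle\to\mathbb K\langle x,y\rangle$ (also written $\frac{\partial}{\partial x},\frac{\partial}{\partial y}$) are defined on monomials by $\partial_x w=u$ if $w=xu$ and $\partial_x w=0$ otherwise; $\partial_y w=u$ if $w=yu$ and $\partial_y w=0$ otherwise. A potential is a cyclicly invariant polynomial $F$, and its potential algebra is $A_F=\mathbb K\langle x,y\rangle/I_F$, where $I_F$ is the two-sided ideal generated by $\partial_xF$ and $\partial_yF$. *)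

theory Defs
  imports "HOL-Library.Poly_Mapping" "HOL-Algebra.Embedded_Algebras" "HOL-Algebra.QuotRing"
begin

section \<open>The free associative algebra on two generators\<close>

datatype letter = X | Y

text \<open>Monomials are words; the wrapper type carries the free monoid structure, written additively
  because the convolution product of \<^theory>\<open>HOL-Library.Poly_Mapping\<close> requires the class
  \<^class>\<open>monoid_add\<close> on exponents.\<close>

datatype monom = Monom (letters: "letter list")

instantiation monom :: monoid_add
begin

definition zero_monom :: monom where "0 = Monom []"

definition plus_monom :: "monom \<Rightarrow> monom \<Rightarrow> monom" where
  "u + v = Monom (letters u @ letters v)"

instance
  by standard (simp_all add: zero_monom_def plus_monom_def)

end

type_synonym 'k free_alg = "monom \<Rightarrow>\<^sub>0 'k"

definition monomial :: "letter list \<Rightarrow> 'k::field free_alg" where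
  "monomial w = Poly_Mapping.single (Monom w) 1"

definition const :: "'k::field \<Rightarrow> 'k free_alg" where
  "const c = Poly_Mapping.single 0 c"

text \<open>The linear map with prescribed values on monomials.\<close>

definition lin_ext :: "(letter list \<Rightarrow> 'k::field free_alg) \<Rightarrow> 'k free_alg \<Rightarrow> 'k free_alg" where
  "lin_ext f p = (\<Sum>m\<in>Poly_Mapping.keys p. const (Poly_Mapping.lookup p m) * f (letters m))"

section \<open>Potentials and potential algebras\<close>

fun rotate_monomial :: "letter list \<Rightarrow> 'k::field free_alg" where
  "rotate_monomial [] = monomial []"
| "rotate_monomial (z # u) = monomial (u @ [z])"

definition cyclicly_invariant :: "'k::field free_alg \<Rightarrow> bool" where
  "cyclicly_invariant F \<longleftrightarrow> lin_ext rotate_monomial F = F"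

fun left_deriv_monomial :: "letter \<Rightarrow> letter list \<Rightarrow> 'k::field free_alg" where
  "left_deriv_monomial z [] = 0"
| "left_deriv_monomial z (a # u) = (if a = z then monomial u else 0)"

definition left_deriv :: "letter \<Rightarrow> 'k::field free_alg \<Rightarrow> 'k free_alg" where
  "left_deriv z = lin_ext (left_deriv_monomial z)"

definition free_algebra :: "'k::field free_alg ring" where
  "free_algebra = \<lparr>carrier = UNIV, mult = (*), one = 1, zero = 0, add = (+)\<rparr>"

definition potential_ideal :: "'k::field free_alg \<Rightarrow> 'k free_alg set" where
  "potential_ideal F = Idl\<^bsub>free_algebra\<^esub> {left_deriv X F, left_deriv Y F}"

definition potential_algebra :: "'k::field free_alg \<Rightarrow> 'k free_alg set ring" where
  "potential_algebra F = free_algebra Quot (potential_ideal F)"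

text \<open>The ground field inside the potential algebra. Its elements are central there, so the left
  multiplication used by \<^const>\<open>ring.finite_dimension\<close> is the scalar action of the ground field.\<close>

definition scalars :: "'k::field free_alg \<Rightarrow> 'k free_alg set set" where
  "scalars F = (\<lambda>c. potential_ideal F +>\<^bsub>free_algebra\<^esub> const c) ` UNIV"

section \<open>Basic facts\<close>

lemma ring_free_algebra: "ring (free_algebra :: 'k::field free_alg ring)"
proof (rule ringI)
  show "abelian_group (free_algebra :: 'k free_alg ring)"
  proof (rule abelian_groupI)
    fix x :: "'k free_alg"
    show "\<exists>y\<in>carrier free_algebra. y \<oplus>\<^bsub>free_algebra\<^esub> x = \<zero>\<^bsub>free_algebra\<^esub>"
      by (rule bexI[of _ "- x"]) (simp_all add: free_algebra_def)
  qed (simp_all add: free_algebra_def add_ac)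
  show "monoid (free_algebra :: 'k free_alg ring)"
    by (rule monoidI) (simp_all add: free_algebra_def mult.assoc)
qed (simp_all add: free_algebra_def algebra_simps)

lemma ideal_potential_ideal: "ideal (potential_ideal F) free_algebra"
  unfolding potential_ideal_def
  by (rule ring.genideal_ideal[OF ring_free_algebra]) (simp add: free_algebra_def)

lemma ring_potential_algebra: "ring (potential_algebra F)"
  unfolding potential_algebra_def by (rule ideal.quotient_is_ring[OF ideal_potential_ideal])

lemma const_0: "const 0 = 0"
  by (simp add: const_def)

lemma const_1: "const 1 = 1"
  by (simp add: const_def)

lemma const_add: "const (a + b) = const a + const b"
  by (simp add: const_def single_add)

lemma const_mult: "const (a * b) = const a * const b"
  by (simp add: const_def mult_single)

lemma monomial_append: "monomial (u @ v) = monomial u * monomial v"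
  by (simp add: monomial_def mult_single plus_monom_def)

lemma lin_ext_monomial: "lin_ext f (monomial w) = f w"
  by (simp add: lin_ext_def monomial_def const_1)

lemma const_commute: "const c * p = p * const c"
proof (induction p rule: update_induct)
  case const
  then show ?case by simp
next
  case (update p m b)
  have "Poly_Mapping.update m b p = p + Poly_Mapping.single m b"
    using update(1)
    by (intro poly_mapping_eqI) (auto simp: lookup_update lookup_add lookup_single in_keys_iff)
  moreover have "const c * Poly_Mapping.single m b = Poly_Mapping.single m b * const c"
    by (simp add: const_def mult_single mult.commute)
  ultimately show ?case
    using update(3) by (simp add: distrib_left distrib_right)
qed

lemma subfield_range_const: "subfield (range (const :: 'k::field \<Rightarrow> _)) free_algebra"
proof (rule ring.subfieldI[OF ring_free_algebra ring.subcringI[OF ring_free_algebra]])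
  show "subring (range (const :: 'k \<Rightarrow> _)) free_algebra"
  proof (rule ring.subringI[OF ring_free_algebra])
    show "\<one>\<^bsub>free_algebra\<^esub> \<in> range (const :: 'k \<Rightarrow> _)"
      unfolding free_algebra_def by (metis const_1 monoid.select_convs(2) rangeI)
    fix h :: "'k free_alg" assume "h \<in> range const"
    then obtain c where c: "h = const c" by auto
    have "const (- c) + const c = 0"
      by (metis add.left_inverse const_0 const_add)
    then have "\<ominus>\<^bsub>free_algebra\<^esub> h = const (- c)"
      by (intro abelian_group.minus_equality[OF ring.is_abelian_group[OF ring_free_algebra]])
         (simp_all add: c free_algebra_def)
    then show "\<ominus>\<^bsub>free_algebra\<^esub> h \<in> range const" by simp
  next
    fix h1 h2 :: "'k free_alg" assume "h1 \<in> range const" "h2 \<in> range const"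
    then obtain a b where ab: "h1 = const a" "h2 = const b" by auto
    show "h1 \<otimes>\<^bsub>free_algebra\<^esub> h2 \<in> range const"
      using const_mult[of a b] by (simp add: free_algebra_def ab) (metis rangeI)
    show "h1 \<oplus>\<^bsub>free_algebra\<^esub> h2 \<in> range const"
      using const_add[of a b] by (simp add: free_algebra_def ab) (metis rangeI)
  qed (simp add: free_algebra_def)
next
  fix h1 h2 :: "'k free_alg" assume "h1 \<in> range const" "h2 \<in> range const"
  then show "h1 \<otimes>\<^bsub>free_algebra\<^esub> h2 = h2 \<otimes>\<^bsub>free_algebra\<^esub> h1"
    unfolding free_algebra_def by (auto intro: const_commute)
next
  have *: "(\<exists>b. const b * const a = 1 \<and> const a * const b = 1) \<longleftrightarrow> const a \<noteq> 0" for a :: 'k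
  proof (cases "a = 0")
    case True
    then show ?thesis by (simp add: const_0)
  next
    case False
    then have inv: "const (inverse a) * const a = 1" "const a * const (inverse a) = 1"
      using const_mult[of "inverse a" a] const_mult[of a "inverse a"] by (simp_all add: const_1)
    have "const a \<noteq> 0"
    proof
      assume "const a = 0"
      with inv(1) show False by simp
    qed
    with inv show ?thesis by blast
  qed
  show "Units (free_algebra\<lparr>carrier := range (const :: 'k \<Rightarrow> _)\<rparr>) =
      range const - {\<zero>\<^bsub>free_algebra\<^esub>}"
  proof (rule Set.set_eqI)
    fix h :: "'k free_alg"
    have "h \<in> Units (free_algebra\<lparr>carrier := range (const :: 'k \<Rightarrow> _)\<rparr>) \<longleftrightarrow>
        h \<in> range const \<and> (\<exists>b. const b * h = 1 \<and> h * const b = 1)"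
      unfolding Units_def free_algebra_def by simp
    also have "\<dots> \<longleftrightarrow> h \<in> range const \<and> h \<noteq> 0"
      by (metis * imageE)
    finally show "h \<in> Units (free_algebra\<lparr>carrier := range (const :: 'k \<Rightarrow> _)\<rparr>) \<longleftrightarrow>
        h \<in> range const - {\<zero>\<^bsub>free_algebra\<^esub>}"
      by (simp add: free_algebra_def)
  qed
qed

lemma subfield_scalars:
  assumes "\<one>\<^bsub>potential_algebra F\<^esub> \<noteq> \<zero>\<^bsub>potential_algebra F\<^esub>"
  shows "subfield (scalars F) (potential_algebra F)"
proof -
  interpret h: ring_hom_ring free_algebra "potential_algebra F"
    "(+>\<^bsub>free_algebra\<^esub>) (potential_ideal F)"
    unfolding potential_algebra_def by (rule ideal.rcos_ring_hom_ring[OF ideal_potential_ideal])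
  show ?thesis
    using h.img_is_subfield(2)[OF subfield_range_const assms]
    by (simp add: scalars_def image_image)
qed

end

theory Submission
  imports Defs "HOL-Library.Function_Algebras"
begin

text \<open>
The proof is a Golod-Shafarevich estimate, sharpened by the syzygy that every potential provides.
Write \<open>r\<^sub>x\<close> and \<open>r\<^sub>y\<close> for the two derivatives of \<open>F\<close>; they only have terms of degree at least four. Let
\<open>d n\<close> be the dimension of the free algebra modulo the ideal \<open>I\<close> generated by \<open>r\<^sub>x, r\<^sub>y\<close> and modulo all
words of length at least \<open>n\<close>. Each \<open>d n\<close> is at most the dimension of the potential algebra, so it
suffices that \<open>d n\<close> is unbounded.

It is convenient to dualise: \<open>d n\<close> is the dimension of the space \<open>D n\<close> of linear functionals on the
free algebra that kill \<open>I\<close> and all words of length at least \<open>n\<close> (\<open>annihilator\<close> below). A functional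
\<open>\<phi>\<close> can be contracted with an element \<open>p\<close> to the functional sending \<open>q\<close> to \<open>\<phi> (q p)\<close>. The functionals
with both contractions by a letter in \<open>D n\<close> form a space \<open>E n\<close> (\<open>extensions\<close> below) of dimension
\<open>2 d n + 1\<close>, since both contractions and the value at 1 can be prescribed freely. Inside \<open>E n\<close>, the
space \<open>D (n + 1)\<close> consists of the functionals having zero contraction with \<open>r\<^sub>x\<close> and with \<open>r\<^sub>y\<close>, and for
degree reasons both contractions lie in \<open>D (n - 3)\<close>.

If the two contractions could be arbitrary, the resulting inequality would be
\<open>d (n + 1) \<ge> 2 d n + 1 - 2 d (n - 3)\<close>, which does not force growth, because \<open>1 - 2t + 2t^4\<close> is positive on
the interval from 0 to 1. But cyclic invariance means \<open>x r\<^sub>x + y r\<^sub>y = r\<^sub>x x + r\<^sub>y y\<close>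
(\<open>potential_syzygy\<close>), and the right-hand side is invisible to \<open>E n\<close>. Hence, if the contraction with
\<open>r\<^sub>x\<close> vanishes, the contraction with \<open>r\<^sub>y\<close> is itself killed by contraction with \<open>y\<close>, so that it is
determined by a scalar and an element of \<open>D (n - 4)\<close>. For \<open>n \<ge> 4\<close> this improves the estimate to
\<open>d (n + 1) \<ge> 2 d n - d (n - 3) - d (n - 4)\<close> (\<open>dim_extensions_le\<close> and \<open>dim_extensions_ge\<close>). Now
\<open>1 - 2t + t^4 + t^5\<close> is negative at \<open>t = 5/8\<close>, and correspondingly \<open>d\<close> grows at least by the factor
\<open>8/5\<close> at each step (\<open>exponential_growth\<close>).
\<close>

section \<open>Dimensions of subspaces of an infinite-dimensional space\<close>

definition scale_fun :: "'k::field \<Rightarrow> ('a \<Rightarrow> 'k) \<Rightarrow> 'a \<Rightarrow> 'k" where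
  "scale_fun c f = (\<lambda>x. c * f x)"

interpretation fs: vector_space scale_fun
  by unfold_locales (auto simp: scale_fun_def algebra_simps fun_eq_iff)

text \<open>The ambient spaces of functions are infinite-dimensional, so finiteness has to be a property of the
subspace, and comparing dimensions of subspaces needs it as a hypothesis.\<close>

definition finite_dimensional :: "('a \<Rightarrow> 'k::field) set \<Rightarrow> bool" where
  "finite_dimensional V \<longleftrightarrow> (\<exists>B. finite B \<and> V \<subseteq> fs.span B)"

lemma finite_dimensional_mono: "finite_dimensional V \<Longrightarrow> U \<subseteq> V \<Longrightarrow> finite_dimensional U"
  unfolding finite_dimensional_def by blast

lemma finite_if_independent_subset:
  assumes "finite_dimensional V" "fs.independent B" "B \<subseteq> V"
  shows "finite B"
  using assms fs.independent_span_bound unfolding finite_dimensional_def by blast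

lemma independent_card_le_dim_of_finite_dimensional:
  assumes "finite_dimensional V" "fs.independent B" "B \<subseteq> V"
  shows "card B \<le> fs.dim V"
proof -
  obtain C where C: "C \<subseteq> V" "fs.independent C" "V \<subseteq> fs.span C" "card C = fs.dim V"
    using fs.basis_exists by blast
  have "finite C" using finite_if_independent_subset assms(1) C(1,2) by blast
  then show ?thesis using fs.independent_span_bound[of C B] assms(2,3) C by auto
qed

lemma dim_mono_of_finite_dimensional:
  assumes "finite_dimensional V" "U \<subseteq> V"
  shows "fs.dim U \<le> fs.dim V"
proof -
  obtain C where "C \<subseteq> U" "fs.independent C" "card C = fs.dim U"
    by (rule fs.basis_exists[of U])
  then show ?thesis
    using independent_card_le_dim_of_finite_dimensional[OF assms(1), of C] assms(2) by auto
qed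

lemma dim_pos_of_finite_dimensional:
  assumes "finite_dimensional V" "v \<in> V" "v \<noteq> 0"
  shows "1 \<le> fs.dim V"
  using independent_card_le_dim_of_finite_dimensional[OF assms(1), of "{v}"] assms(2,3)
  by (simp only: fs.dependent_single card.insert finite.emptyI card.empty) simp

text \<open>Rank and nullity, upper bound: a basis of the kernel together with preimages of a basis of the image
spans \<open>U\<close>.\<close>

lemma dim_le_dim_kernel_plus_dim_image:
  assumes f: "Vector_Spaces.linear scale_fun scale_fun f"
    and U: "fs.subspace U"
    and K: "finite_dimensional {u \<in> U. f u = 0}" and I: "finite_dimensional (f ` U)"
  shows "finite_dimensional U \<and> fs.dim U \<le> fs.dim {u \<in> U. f u = 0} + fs.dim (f ` U)"
proof -
  interpret f: Vector_Spaces.linear scale_fun scale_fun f by (rule f)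
  obtain B where B: "B \<subseteq> {u \<in> U. f u = 0}" "fs.independent B"
    "{u \<in> U. f u = 0} \<subseteq> fs.span B" "card B = fs.dim {u \<in> U. f u = 0}"
    using fs.basis_exists by blast
  obtain E where E: "E \<subseteq> f ` U" "fs.independent E" "f ` U \<subseteq> fs.span E" "card E = fs.dim (f ` U)"
    using fs.basis_exists by blast
  have fin: "finite B" "finite E"
    using finite_if_independent_subset[OF K B(2,1)]
      finite_if_independent_subset[OF I E(2,1)] by auto
  obtain E' where E': "E' \<subseteq> U" "f ` E' = E" "finite E'" "card E' = card E"
    using E(1) fin(2) unfolding subset_image_inj by (metis finite_image_iff card_image)
  have span: "U \<subseteq> fs.span (B \<union> E')"
  proof
    fix u assume u: "u \<in> U"
    then have "f u \<in> f ` fs.span E'"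
      using E(3) E'(2) f.span_image[of E'] by auto
    then obtain s where s: "s \<in> fs.span E'" "f u = f s" by auto
    have "s \<in> U" using s(1) E'(1) U fs.span_minimal by blast
    then have "u - s \<in> {u \<in> U. f u = 0}"
      using u s(2) U by (simp add: fs.subspace_diff f.diff)
    then have "u - s \<in> fs.span (B \<union> E')"
      using B(3) fs.span_mono[of B "B \<union> E'"] by auto
    moreover have "s \<in> fs.span (B \<union> E')"
      using s(1) fs.span_mono[of E' "B \<union> E'"] by auto
    ultimately show "u \<in> fs.span (B \<union> E')"
      using fs.span_add by fastforce
  qed
  have "fs.dim U \<le> card (B \<union> E')"
    using fs.dim_le_card[OF span] fin(1) E'(3) by simp
  also have "\<dots> \<le> card B + card E'" by (rule card_Un_le)
  finally show ?thesis
    using span fin(1) E'(3,4) B(4) E(4) unfolding finite_dimensional_def by (metis finite_UnI)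
qed

text \<open>Rank and nullity, lower bound: after extending a basis \<open>B\<close> of the kernel to a basis \<open>C\<close> of \<open>U\<close>,
the images of the \<open>card C - card B\<close> additional vectors span the image.\<close>

lemma dim_kernel_plus_dim_image_le:
  assumes f: "Vector_Spaces.linear scale_fun scale_fun f"
    and fin: "finite_dimensional U"
  shows "fs.dim {u \<in> U. f u = 0} + fs.dim (f ` U) \<le> fs.dim U"
proof -
  interpret f: Vector_Spaces.linear scale_fun scale_fun f by (rule f)
  obtain B where B: "B \<subseteq> {u \<in> U. f u = 0}" "fs.independent B" "card B = fs.dim {u \<in> U. f u = 0}"
    by (rule fs.basis_exists[of "{u \<in> U. f u = 0}"])
  then obtain C where C: "B \<subseteq> C" "C \<subseteq> U" "fs.independent C" "U \<subseteq> fs.span C"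
    using fs.maximal_independent_subset_extend[of B U] by blast
  have finC: "finite C" by (rule finite_if_independent_subset[OF fin C(3,2)])
  have "f ` U \<subseteq> fs.span (f ` (C - B))"
  proof -
    have "f ` U \<subseteq> fs.span (f ` C)" using C(4) f.span_image[of C] by auto
    also have "\<dots> \<subseteq> fs.span (f ` (C - B))"
    proof (rule fs.span_minimal)
      show "f ` C \<subseteq> fs.span (f ` (C - B))"
      proof (rule image_subsetI)
        fix c assume "c \<in> C"
        show "f c \<in> fs.span (f ` (C - B))"
        proof (cases "c \<in> B")
          case True
          then have "f c = 0" using B(1) by auto
          then show ?thesis by (simp only: fs.span_zero)
        next
          case False
          with \<open>c \<in> C\<close> show ?thesis by (intro fs.span_base) simp
        qed
      qed
    qed simp
    finally show ?thesis .
  qed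
  then have "fs.dim (f ` U) \<le> card (f ` (C - B))"
    using finC by (intro fs.dim_le_card) auto
  also have "\<dots> \<le> card (C - B)" using finC by (intro card_image_le) auto
  also have "\<dots> = card C - card B" using C(1) finC by (meson card_Diff_subset finite_subset)
  finally have "fs.dim (f ` U) + card B \<le> card C"
    using card_mono[OF finC C(1)] by linarith
  moreover have "card C \<le> fs.dim U"
    using independent_card_le_dim_of_finite_dimensional[OF fin C(3,2)] .
  ultimately show ?thesis using B(3) by linarith
qed

text \<open>Evaluation at the points of \<open>vs\<close> embeds \<open>U\<close> into a coordinate space. The points are imposed one at a
time, each evaluation having rank at most one. This bound serves three purposes: functionals on a
truncated free algebra are finite-dimensional, a functional determined by its value at 1 ranges over
a line, and a spanning set of the potential algebra bounds the space of functionals on it.\<close>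

lemma dim_le_length_if_separated:
  fixes U :: "('a \<Rightarrow> 'k::field) set"
  assumes "fs.subspace U" and "\<And>f. f \<in> U \<Longrightarrow> (\<forall>v\<in>set vs. f v = 0) \<Longrightarrow> f = 0"
  shows "finite_dimensional U \<and> fs.dim U \<le> length vs"
  using assms
proof (induction vs arbitrary: U)
  case Nil
  then have "U \<subseteq> {0}" unfolding list.set by blast
  then have "U \<subseteq> fs.span {}" unfolding fs.span_empty .
  then show ?case
    using fs.dim_le_card[of U "{}"] unfolding finite_dimensional_def
    by (metis card.empty finite.emptyI list.size(3))
next
  case (Cons v vs)
  \<comment> \<open>Evaluation at \<open>v\<close>, with the scalar regarded as a constant function so that it is an endomorphism.\<close>
  define ev :: "('a \<Rightarrow> 'k) \<Rightarrow> 'a \<Rightarrow> 'k" where "ev = (\<lambda>f _. f v)"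
  have linear: "Vector_Spaces.linear scale_fun scale_fun ev"
    by unfold_locales (auto simp: ev_def scale_fun_def fun_eq_iff)
  have kernel: "{f \<in> U. ev f = 0} = {f \<in> U. f v = 0}"
    by (auto simp: ev_def fun_eq_iff)
  have IH: "finite_dimensional {f \<in> U. f v = 0} \<and> fs.dim {f \<in> U. f v = 0} \<le> length vs"
  proof (rule Cons.IH)
    show "fs.subspace {f \<in> U. f v = 0}"
    proof (rule fs.subspaceI)
      show "0 \<in> {f \<in> U. f v = 0}" using fs.subspace_0[OF Cons.prems(1)] by simp
    next
      fix f g assume "f \<in> {f \<in> U. f v = 0}" "g \<in> {f \<in> U. f v = 0}"
      then show "f + g \<in> {f \<in> U. f v = 0}"
        using fs.subspace_add[OF Cons.prems(1)] by simp
    next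
      fix c f assume "f \<in> {f \<in> U. f v = 0}"
      then show "scale_fun c f \<in> {f \<in> U. f v = 0}"
        using fs.subspace_scale[OF Cons.prems(1), of f c] by (auto simp: scale_fun_def)
    qed
  qed (use Cons.prems(2) in auto)
  have image: "ev ` U \<subseteq> fs.span {1}"
    by (auto simp: ev_def fs.span_singleton scale_fun_def fun_eq_iff)
  then have "fs.dim (ev ` U) \<le> card {1 :: 'a \<Rightarrow> 'k}"
    by (rule fs.dim_le_card) simp
  moreover have "finite_dimensional (ev ` U)"
    using image unfolding finite_dimensional_def by blast
  ultimately show ?case
    using dim_le_dim_kernel_plus_dim_image[OF linear Cons.prems(1)] IH unfolding kernel by simp
qed

section \<open>Splitting off one letter in the free algebra\<close>

abbreviation var :: "letter \<Rightarrow> 'k::field free_alg" where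
  "var z \<equiv> monomial [z]"

lemma free_alg_induct [case_names monomial add scale]:
  fixes p :: "'k::field free_alg"
  assumes "\<And>w. P (monomial w)" "\<And>p q. P p \<Longrightarrow> P q \<Longrightarrow> P (p + q)" "\<And>c p. P p \<Longrightarrow> P (const c * p)"
  shows "P p"
proof (induction p rule: update_induct)
  case const
  show ?case using assms(3)[of "monomial []" 0] assms(1)[of "[]"] by (simp add: const_0)
next
  case (update p m b)
  have "Poly_Mapping.update m b p = p + const b * monomial (letters m)"
    using update(1)
    by (intro poly_mapping_eqI)
      (auto simp: lookup_update lookup_add lookup_single in_keys_iff const_def monomial_def mult_single)
  then show ?case using assms update(3) by simp
qed

definition order_ge :: "nat \<Rightarrow> 'k::field free_alg set" where
  "order_ge n = {p. \<forall>m\<in>Poly_Mapping.keys p. n \<le> length (letters m)}"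

lemma order_ge_0 [simp]: "p \<in> order_ge 0"
  by (simp add: order_ge_def)

lemma order_ge_antimono: "p \<in> order_ge n \<Longrightarrow> m \<le> n \<Longrightarrow> p \<in> order_ge m"
  by (auto simp: order_ge_def)

lemma order_ge_mult: "p \<in> order_ge m \<Longrightarrow> q \<in> order_ge n \<Longrightarrow> p * q \<in> order_ge (m + n)"
  using keys_mult[of p q] by (fastforce simp: order_ge_def plus_monom_def)

lemma var_in_order_ge: "var z \<in> order_ge 1"
  by (simp add: order_ge_def monomial_def)

lemma lookup_0_of_order_ge: "p \<in> order_ge 1 \<Longrightarrow> Poly_Mapping.lookup p 0 = 0"
  by (force simp: order_ge_def in_keys_iff zero_monom_def)

text \<open>The coefficient of \<open>w\<close> in \<open>right_deriv z p\<close> is that of \<open>w z\<close> in \<open>p\<close>: the mirror image of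
\<^const>\<open>left_deriv\<close>.\<close>

definition right_deriv :: "letter \<Rightarrow> 'k::field free_alg \<Rightarrow> 'k free_alg" where
  "right_deriv z p = Poly_Mapping.map_key (\<lambda>m. m + Monom [z]) p"

lemma inj_append_letter: "inj (\<lambda>m. m + Monom [z])"
  by (rule injI) (auto simp: plus_monom_def intro: monom.expand)

lemma lookup_right_deriv:
  "Poly_Mapping.lookup (right_deriv z p) m = Poly_Mapping.lookup p (m + Monom [z])"
  by (simp add: right_deriv_def map_key.rep_eq inj_append_letter)

lemma lookup_const_mult:
  "Poly_Mapping.lookup (const c * p) m = c * Poly_Mapping.lookup p m"
proof (induction p arbitrary: c rule: free_alg_induct)
  case (monomial w)
  show ?case by (simp add: const_def monomial_def mult_single lookup_single when_def)
next
  case (add p q)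
  then show ?case by (simp add: distrib_left lookup_add)
next
  case (scale d p)
  have "const c * (const d * p) = const (c * d) * p" by (simp add: const_mult mult.assoc)
  then show ?case by (simp add: scale)
qed

lemma right_deriv_add: "right_deriv z (p + q) = right_deriv z p + right_deriv z q"
  by (intro poly_mapping_eqI) (simp add: lookup_right_deriv lookup_add)

lemma right_deriv_scale: "right_deriv z (const c * p) = const c * right_deriv z p"
  by (intro poly_mapping_eqI) (simp add: lookup_right_deriv lookup_const_mult)

lemma right_deriv_monomial_snoc:
  "right_deriv z (monomial (u @ [a])) = (if a = z then monomial u else 0)"
  by (intro poly_mapping_eqI)
    (auto simp: lookup_right_deriv monomial_def lookup_single when_def plus_monom_def
      intro: monom.expand)

lemma right_deriv_mult_var: "right_deriv z (p * var a) = (if a = z then p else 0)"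
proof (induction p rule: free_alg_induct)
  case (monomial w)
  then show ?case by (simp flip: monomial_append add: right_deriv_monomial_snoc)
qed (auto simp: distrib_right right_deriv_add right_deriv_scale mult.assoc)

lemma right_deriv_one: "right_deriv z 1 = 0"
  by (intro poly_mapping_eqI)
    (auto simp: lookup_right_deriv lookup_one when_def plus_monom_def zero_monom_def)

lemma right_deriv_order_ge: "p \<in> order_ge (Suc n) \<Longrightarrow> right_deriv z p \<in> order_ge n"
  by (force simp: order_ge_def in_keys_iff lookup_right_deriv plus_monom_def)

lemma monomial_Nil: "monomial [] = 1"
  by (simp add: monomial_def flip: zero_monom_def)

text \<open>The augmentation ideal is free as a left module on the two letters. Everything that is proved by
peeling off last letters rests on this decomposition.\<close>

lemma right_decomposition:
  "p = const (Poly_Mapping.lookup p 0) + right_deriv X p * var X + right_deriv Y p * var Y"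
proof (induction p rule: free_alg_induct)
  case (monomial w)
  show ?case
  proof (cases w rule: rev_cases)
    case Nil
    then show ?thesis by (simp add: monomial_Nil right_deriv_one const_1 lookup_one)
  next
    case (snoc u a)
    have "Poly_Mapping.lookup (monomial w :: 'a free_alg) 0 = 0"
      by (simp add: snoc monomial_def lookup_single zero_monom_def)
    then show ?thesis
      by (cases a) (simp_all add: snoc right_deriv_mult_var const_0 monomial_append)
  qed
next
  case (add p q)
  have "p + q = (const (Poly_Mapping.lookup p 0) + right_deriv X p * var X + right_deriv Y p * var Y)
      + (const (Poly_Mapping.lookup q 0) + right_deriv X q * var X + right_deriv Y q * var Y)"
    using add by (rule arg_cong2)
  also have "\<dots> = const (Poly_Mapping.lookup (p + q) 0) + right_deriv X (p + q) * var X + right_deriv Y (p + q) * var Y"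
    by (simp add: lookup_add const_add right_deriv_add algebra_simps)
  finally show ?case .
next
  case (scale c p)
  have "const c * p
      = const c * (const (Poly_Mapping.lookup p 0) + right_deriv X p * var X + right_deriv Y p * var Y)"
    using scale by (rule arg_cong)
  also have "\<dots> = const (Poly_Mapping.lookup (const c * p) 0)
      + right_deriv X (const c * p) * var X + right_deriv Y (const c * p) * var Y"
    by (simp add: lookup_const_mult const_mult right_deriv_scale distrib_left mult.assoc)
  finally show ?case .
qed

corollary right_decomposition_order_ge:
  assumes "p \<in> order_ge (Suc n)"
  shows "p = right_deriv X p * var X + right_deriv Y p * var Y"
proof -
  have "Poly_Mapping.lookup p 0 = 0"
    using order_ge_antimono[OF assms, of 1] by (intro lookup_0_of_order_ge) simp
  then show ?thesis using right_decomposition[of p] by (simp add: const_0)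
qed

section \<open>The syzygy of a potential\<close>

lemma lin_ext_superset:
  assumes "finite S" "Poly_Mapping.keys p \<subseteq> S"
  shows "lin_ext f p = (\<Sum>m\<in>S. const (Poly_Mapping.lookup p m) * f (letters m))"
  unfolding lin_ext_def using assms
  by (intro sum.mono_neutral_left) (auto simp: in_keys_iff const_0)

lemma lin_ext_add: "lin_ext f (p + q) = lin_ext f p + lin_ext f q"
proof -
  let ?S = "Poly_Mapping.keys p \<union> Poly_Mapping.keys q"
  have "Poly_Mapping.keys (p + q) \<subseteq> ?S" by (rule keys_add)
  then show ?thesis
    using lin_ext_superset[of ?S p f] lin_ext_superset[of ?S q f] lin_ext_superset[of ?S "p + q" f]
    by (simp add: lookup_add const_add distrib_right sum.distrib)
qed

lemma lin_ext_scale: "lin_ext f (const c * p) = const c * lin_ext f p"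
proof -
  have "Poly_Mapping.keys (const c * p) \<subseteq> Poly_Mapping.keys p"
    by (auto simp: in_keys_iff lookup_const_mult)
  then show ?thesis
    using lin_ext_superset[of "Poly_Mapping.keys p" p f]
      lin_ext_superset[of "Poly_Mapping.keys p" "const c * p" f]
    by (simp add: lookup_const_mult const_mult sum_distrib_left mult.assoc)
qed

lemma left_deriv_add: "left_deriv z (p + q) = left_deriv z p + left_deriv z q"
  by (simp add: left_deriv_def lin_ext_add)

lemma left_deriv_scale: "left_deriv z (const c * p) = const c * left_deriv z p"
  by (simp add: left_deriv_def lin_ext_scale)

lemma left_deriv_monomial:
  "left_deriv z (monomial w) = left_deriv_monomial z w"
  by (simp add: left_deriv_def lin_ext_monomial)

lemma left_deriv_one: "left_deriv z 1 = 0"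
  by (simp add: left_deriv_monomial flip: monomial_Nil)

lemma lookup_left_deriv:
  "Poly_Mapping.lookup (left_deriv z p) m = Poly_Mapping.lookup p (Monom [z] + m)"
proof (induction p rule: free_alg_induct)
  case (monomial w)
  show ?case
    unfolding left_deriv_monomial
    by (cases w) (auto simp: monomial_def lookup_single when_def plus_monom_def intro: monom.expand)
qed (simp_all add: left_deriv_add left_deriv_scale lookup_add lookup_const_mult)

lemma left_deriv_order_ge: "p \<in> order_ge (Suc n) \<Longrightarrow> left_deriv z p \<in> order_ge n"
  by (force simp: order_ge_def in_keys_iff lookup_left_deriv plus_monom_def)

lemma left_decomposition:
  "p = const (Poly_Mapping.lookup p 0) + var X * left_deriv X p + var Y * left_deriv Y p"
proof (induction p rule: free_alg_induct)
  case (monomial w)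
  show ?case
  proof (cases w)
    case Nil
    then show ?thesis by (simp add: monomial_Nil left_deriv_one const_1 lookup_one)
  next
    case (Cons a u)
    have "Poly_Mapping.lookup (monomial w :: 'a free_alg) 0 = 0"
      by (simp add: Cons monomial_def lookup_single zero_monom_def)
    then show ?thesis
      by (cases a) (simp_all add: Cons left_deriv_monomial const_0 flip: monomial_append)
  qed
next
  case (add p q)
  have "p + q = (const (Poly_Mapping.lookup p 0) + var X * left_deriv X p + var Y * left_deriv Y p)
      + (const (Poly_Mapping.lookup q 0) + var X * left_deriv X q + var Y * left_deriv Y q)"
    using add by (rule arg_cong2)
  also have "\<dots> = const (Poly_Mapping.lookup (p + q) 0) + var X * left_deriv X (p + q) + var Y * left_deriv Y (p + q)"
    by (simp add: lookup_add const_add left_deriv_add algebra_simps)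
  finally show ?case .
next
  case (scale c p)
  have "const c * p
      = const c * (const (Poly_Mapping.lookup p 0) + var X * left_deriv X p + var Y * left_deriv Y p)"
    using scale by (rule arg_cong)
  also have "\<dots> = const (c * Poly_Mapping.lookup p 0) + var X * (const c * left_deriv X p)
      + var Y * (const c * left_deriv Y p)"
    using const_commute[of c "var X"] const_commute[of c "var Y"]
    by (simp add: const_mult distrib_left flip: mult.assoc)
  finally show ?case unfolding lookup_const_mult left_deriv_scale .
qed

text \<open>Rotating moves the first letter, which the left derivative removes, to the end of the word.\<close>

lemma rotation_decomposition:
  "lin_ext rotate_monomial p
    = const (Poly_Mapping.lookup p 0) + left_deriv X p * var X + left_deriv Y p * var Y"
proof (induction p rule: free_alg_induct)
  case (monomial w)
  show ?case
  proof (cases w)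
    case Nil
    moreover have "lin_ext rotate_monomial (monomial []) = (1 :: 'a free_alg)"
      by (simp only: lin_ext_monomial rotate_monomial.simps) (rule monomial_Nil)
    ultimately show ?thesis by (simp add: monomial_Nil left_deriv_one const_1 lookup_one)
  next
    case (Cons a u)
    have "Poly_Mapping.lookup (monomial w :: 'a free_alg) 0 = 0"
      by (simp add: Cons monomial_def lookup_single zero_monom_def)
    then show ?thesis
      by (cases a)
        (simp_all add: Cons lin_ext_monomial left_deriv_monomial const_0 flip: monomial_append)
  qed
qed (simp_all add: lin_ext_add lin_ext_scale lookup_add lookup_const_mult const_add const_mult
    left_deriv_add left_deriv_scale distrib_left distrib_right mult.assoc add_ac)

text \<open>Both sides are \<open>F\<close> without its constant term, the left one by splitting off first letters, the right
one because \<open>F\<close> is its own rotation. This is the one place where cyclic invariance enters.\<close>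

lemma potential_syzygy:
  assumes "cyclicly_invariant F"
  shows "var X * left_deriv X F + var Y * left_deriv Y F
    = left_deriv X F * var X + left_deriv Y F * var Y"
proof -
  have "const (Poly_Mapping.lookup F 0) + (var X * left_deriv X F + var Y * left_deriv Y F) = F"
    unfolding add.assoc[symmetric] by (rule left_decomposition[symmetric])
  also have "F = lin_ext rotate_monomial F"
    using assms unfolding cyclicly_invariant_def by (rule sym)
  also have "\<dots> = const (Poly_Mapping.lookup F 0)
      + (left_deriv X F * var X + left_deriv Y F * var Y)"
    unfolding add.assoc[symmetric] by (rule rotation_decomposition)
  finally show ?thesis by (rule add_left_imp_eq)
qed

section \<open>Functionals killing the relations\<close>

definition functionals :: "('k::field free_alg \<Rightarrow> 'k) set" where
  "functionals = {\<phi>. (\<forall>p q. \<phi> (p + q) = \<phi> p + \<phi> q) \<and> (\<forall>c p. \<phi> (const c * p) = c * \<phi> p)}"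

lemma functional_add: "\<phi> \<in> functionals \<Longrightarrow> \<phi> (p + q) = \<phi> p + \<phi> q"
  by (simp add: functionals_def)

lemma functional_scale: "\<phi> \<in> functionals \<Longrightarrow> \<phi> (const c * p) = c * \<phi> p"
  by (simp add: functionals_def)

lemma functional_0: "\<phi> \<in> functionals \<Longrightarrow> \<phi> 0 = 0"
  using functional_scale[of \<phi> 0 0] by simp

lemma subspace_functionals: "fs.subspace functionals"
  by (rule fs.subspaceI) (auto simp: functionals_def scale_fun_def algebra_simps)

lemma subspace_functionals_killing:
  "fs.subspace {\<phi> \<in> functionals. \<forall>p\<in>S. \<phi> p = 0}"
proof (rule fs.subspaceI)
  show "0 \<in> {\<phi> \<in> functionals. \<forall>p\<in>S. \<phi> p = 0}"
    using fs.subspace_0[OF subspace_functionals] by simp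
next
  fix \<phi> \<psi> :: "'a free_alg \<Rightarrow> 'a"
  assume "\<phi> \<in> {\<phi> \<in> functionals. \<forall>p\<in>S. \<phi> p = 0}" "\<psi> \<in> {\<phi> \<in> functionals. \<forall>p\<in>S. \<phi> p = 0}"
  then show "\<phi> + \<psi> \<in> {\<phi> \<in> functionals. \<forall>p\<in>S. \<phi> p = 0}"
    using fs.subspace_add[OF subspace_functionals, of \<phi> \<psi>] by simp
next
  fix c and \<phi> :: "'a free_alg \<Rightarrow> 'a"
  assume "\<phi> \<in> {\<phi> \<in> functionals. \<forall>p\<in>S. \<phi> p = 0}"
  then show "scale_fun c \<phi> \<in> {\<phi> \<in> functionals. \<forall>p\<in>S. \<phi> p = 0}"
    using fs.subspace_scale[OF subspace_functionals, of \<phi> c] by (simp add: scale_fun_def)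
qed

lemma finite_words: "finite {w :: letter list. length w < n}"
proof -
  have "finite (UNIV :: letter set)"
    using letter.exhaust by (intro finite_subset[of UNIV "{X, Y}"]) auto
  then have "finite {w :: letter list. set w \<subseteq> UNIV \<and> length w \<le> n}"
    by (rule finite_lists_length_le)
  then show ?thesis by (rule rev_finite_subset) auto
qed

text \<open>Such a functional is determined by its values on the finitely many shorter words.\<close>

lemma finite_dimensional_functionals_killing_order_ge:
  "finite_dimensional {\<phi> \<in> functionals. \<forall>p\<in>order_ge n. \<phi> p = (0 :: 'k::field)}"
proof -
  obtain ws where ws: "set ws = {w :: letter list. length w < n}"
    using finite_list[OF finite_words] by blast
  have "\<phi> = 0" if \<phi>: "\<phi> \<in> functionals" "\<forall>p\<in>order_ge n. \<phi> p = 0"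
    and van: "\<forall>v\<in>set (map monomial ws). \<phi> v = 0" for \<phi> :: "'k free_alg \<Rightarrow> 'k"
  proof
    fix p
    show "\<phi> p = 0 p"
    proof (induction p rule: free_alg_induct)
      case (monomial w)
      show ?case
      proof (cases "length w < n")
        case True
        then show ?thesis using van ws by simp
      next
        case False
        then have "(monomial w :: 'k free_alg) \<in> order_ge n" by (simp add: order_ge_def monomial_def)
        then show ?thesis using \<phi>(2) by simp
      qed
    qed (simp_all add: functional_add functional_scale \<phi>(1))
  qed
  then show ?thesis
    using dim_le_length_if_separated[OF subspace_functionals_killing, of "order_ge n" "map monomial ws"]
    by blast
qed

text \<open>The dual space of an algebra is a module over it; \<open>contract p\<close> is dual to right multiplication by
\<open>p\<close>. Accordingly \<open>contract q (contract p \<phi>) = contract (q * p) \<phi>\<close>.\<close>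

definition contract :: "'k::field free_alg \<Rightarrow> ('k free_alg \<Rightarrow> 'k) \<Rightarrow> 'k free_alg \<Rightarrow> 'k" where
  "contract p \<phi> = (\<lambda>q. \<phi> (q * p))"

lemma linear_contract: "Vector_Spaces.linear scale_fun scale_fun (contract p)"
  by unfold_locales (auto simp: contract_def scale_fun_def fun_eq_iff)

lemma contract_functional: "\<phi> \<in> functionals \<Longrightarrow> contract p \<phi> \<in> functionals"
  by (simp add: functionals_def contract_def distrib_right mult.assoc)

text \<open>What the growth estimate uses about the two derivatives of a potential with terms of degree at least
five: they start in degree four, and the sum of their commutators with the variables is zero.\<close>

locale potential_relations =
  fixes r :: "letter \<Rightarrow> 'k::field free_alg"
  assumes order: "r z \<in> order_ge 4"
    and syzygy: "var X * r X + var Y * r Y = r X * var X + r Y * var Y"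
begin

text \<open>The dual space of the free algebra modulo the relations and modulo the words of length at least
\<open>n\<close>. Working with functionals avoids choosing complements of the ideal.\<close>

definition annihilator :: "nat \<Rightarrow> ('k free_alg \<Rightarrow> 'k) set" where
  "annihilator n =
    {\<phi> \<in> functionals. \<forall>p \<in> order_ge n \<union> {a * r z * b |a z b. True}. \<phi> p = 0}"

text \<open>The functionals that have both contractions by a letter in \<open>annihilator n\<close>. They include
\<open>annihilator (Suc n)\<close> and come close to it: a product \<open>a * r z * b\<close> is killed as soon as \<open>b\<close> has no
constant term, so that only the products \<open>a * r z\<close> remain to be dealt with.\<close>

definition extensions :: "nat \<Rightarrow> ('k free_alg \<Rightarrow> 'k) set" where
  "extensions n = {\<phi> \<in> functionals. \<forall>z. contract (var z) \<phi> \<in> annihilator n}"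

definition Y_torsion :: "nat \<Rightarrow> ('k free_alg \<Rightarrow> 'k) set" where
  "Y_torsion n = {\<phi> \<in> annihilator n. contract (var Y) \<phi> = 0}"

lemma annihilator_iff:
  "\<phi> \<in> annihilator n \<longleftrightarrow>
    \<phi> \<in> functionals \<and> (\<forall>p\<in>order_ge n. \<phi> p = 0) \<and> (\<forall>a z b. \<phi> (a * r z * b) = 0)"
  by (auto simp: annihilator_def)

lemma subspace_annihilator: "fs.subspace (annihilator n)"
  unfolding annihilator_def by (rule subspace_functionals_killing)

lemma subspace_kernel_in:
  assumes "fs.subspace U"
  shows "fs.subspace {\<phi> \<in> U. contract p \<phi> = 0}"
proof -
  interpret c: Vector_Spaces.linear scale_fun scale_fun "contract p" by (rule linear_contract)
  show ?thesis
    using fs.subspace_inter[OF assms c.subspace_kernel] by (simp add: Int_def)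
qed

lemma all_letter_iff: "(\<forall>z. P z) \<longleftrightarrow> P X \<and> P Y"
  by (metis letter.exhaust)

lemma subspace_extensions: "fs.subspace (extensions n)"
proof -
  have "fs.subspace (contract (var z) -` annihilator n)" for z
  proof -
    interpret c: Vector_Spaces.linear scale_fun scale_fun "contract (var z)" by (rule linear_contract)
    show ?thesis by (rule c.subspace_vimage[OF subspace_annihilator])
  qed
  then have "fs.subspace (functionals \<inter> (contract (var X) -` annihilator n)
      \<inter> (contract (var Y) -` annihilator n))"
    by (intro fs.subspace_inter subspace_functionals)
  moreover have "extensions n = functionals \<inter> (contract (var X) -` annihilator n)
      \<inter> (contract (var Y) -` annihilator n)"
    unfolding extensions_def all_letter_iff by blast
  ultimately show ?thesis by simp
qed

lemma finite_dimensional_annihilator: "finite_dimensional (annihilator n)"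
  by (rule finite_dimensional_mono[OF finite_dimensional_functionals_killing_order_ge[of n]])
    (auto simp: annihilator_iff)

lemma extensions_kill_order_ge:
  assumes \<phi>: "\<phi> \<in> extensions n" and p: "p \<in> order_ge (Suc n)"
  shows "\<phi> p = 0"
proof -
  have "contract (var z) \<phi> (right_deriv z p) = 0" for z
    using \<phi> right_deriv_order_ge[OF p] by (auto simp: extensions_def annihilator_iff)
  then have "\<phi> (right_deriv z p * var z) = 0" for z by (simp add: contract_def)
  then show ?thesis
    using right_decomposition_order_ge[OF p] functional_add \<phi>
    unfolding extensions_def by (metis (no_types, lifting) add_0 mem_Collect_eq)
qed

lemma finite_dimensional_extensions: "finite_dimensional (extensions n)"
  by (rule finite_dimensional_mono[OF finite_dimensional_functionals_killing_order_ge[of "Suc n"]])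
    (auto simp: extensions_kill_order_ge, auto simp: extensions_def)

lemma finite_dimensional_Y_torsion: "finite_dimensional (Y_torsion n)"
  by (rule finite_dimensional_mono[OF finite_dimensional_annihilator[of n]]) (auto simp: Y_torsion_def)

lemma dim_annihilator_0: "fs.dim (annihilator 0) = 0"
proof -
  have "annihilator 0 \<subseteq> fs.span {}"
    by (auto simp: annihilator_iff fun_eq_iff)
  then have "fs.dim (annihilator 0) \<le> card ({} :: ('k free_alg \<Rightarrow> 'k) set)"
    by (rule fs.dim_le_card) simp
  then show ?thesis by simp
qed

lemma annihilator_contract_var:
  assumes "\<phi> \<in> annihilator n"
  shows "contract (var z) \<phi> \<in> annihilator (n - 1)"
  unfolding annihilator_iff
proof (intro conjI allI ballI)
  show "contract (var z) \<phi> \<in> functionals"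
    using assms by (simp add: annihilator_iff contract_functional)
next
  fix p :: "'k free_alg" assume "p \<in> order_ge (n - 1)"
  then have "p * var z \<in> order_ge n"
    using order_ge_mult[OF _ var_in_order_ge] order_ge_antimono by (metis le_diff_conv order_refl)
  then show "contract (var z) \<phi> p = 0"
    using assms by (simp add: annihilator_iff contract_def)
next
  fix a z' b
  have "\<phi> (a * r z' * (b * var z)) = 0" using assms by (simp add: annihilator_iff)
  then show "contract (var z) \<phi> (a * r z' * b) = 0" by (simp add: contract_def mult.assoc)
qed

lemma extensions_kill:
  assumes \<phi>: "\<phi> \<in> extensions n" and b: "b \<in> order_ge 1"
  shows "\<phi> (a * r z * b) = 0"
proof -
  have "contract (var y) \<phi> (a * r z * right_deriv y b) = 0" for y
    using \<phi> by (auto simp: extensions_def annihilator_iff)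
  then have *: "\<phi> (a * r z * (right_deriv y b * var y)) = 0" for y
    by (simp add: contract_def mult.assoc)
  have "b = right_deriv X b * var X + right_deriv Y b * var Y"
    using b by (intro right_decomposition_order_ge) simp
  then have "a * r z * b
      = a * r z * (right_deriv X b * var X) + a * r z * (right_deriv Y b * var Y)"
    by (metis distrib_left)
  then show ?thesis
    using * \<phi> functional_add[of \<phi>] by (simp add: extensions_def)
qed

text \<open>Multiplying by a relation on the right raises degrees by four, while functionals in \<open>extensions n\<close>
kill degrees above \<open>n\<close>; this is the origin of the shift by three.\<close>

lemma extensions_contract_relation:
  assumes \<phi>: "\<phi> \<in> extensions n"
  shows "contract (r z) \<phi> \<in> annihilator (n - 3)"
  unfolding annihilator_iff
proof (intro conjI allI ballI)
  show "contract (r z) \<phi> \<in> functionals"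
    using \<phi> by (simp add: extensions_def contract_functional)
next
  fix p :: "'k free_alg" assume "p \<in> order_ge (n - 3)"
  then have "p * r z \<in> order_ge (Suc n)"
    using order_ge_antimono[OF order_ge_mult[OF _ order], of p "n - 3" "Suc n"] by simp
  then show "contract (r z) \<phi> p = 0"
    using extensions_kill_order_ge[OF \<phi>] by (simp add: contract_def)
next
  fix a z' b
  have "b * r z \<in> order_ge 1"
    using order_ge_antimono[OF order_ge_mult[OF order_ge_0 order]] by simp
  then have "\<phi> (a * r z' * (b * r z)) = 0" by (rule extensions_kill[OF \<phi>])
  then show "contract (r z) \<phi> (a * r z' * b) = 0" by (simp add: contract_def mult.assoc)
qed

text \<open>The constant term of the right factor \<open>b\<close> is the only part of \<open>a * r z * b\<close> that membership in
\<open>extensions n\<close> does not control, and it is central.\<close>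

lemma annihilator_if_contract_relations_eq_0:
  assumes \<phi>: "\<phi> \<in> extensions n" and zero: "\<And>z. contract (r z) \<phi> = 0"
  shows "\<phi> \<in> annihilator (Suc n)"
  unfolding annihilator_iff
proof (intro conjI allI ballI)
  show lin: "\<phi> \<in> functionals" using \<phi> by (simp add: extensions_def)
  show "\<phi> p = 0" if "p \<in> order_ge (Suc n)" for p
    using extensions_kill_order_ge[OF \<phi> that] .
  fix a z and b :: "'k free_alg"
  define c where "c = Poly_Mapping.lookup b 0"
  define b' where "b' = right_deriv X b * var X + right_deriv Y b * var Y"
  have "right_deriv y b * var y \<in> order_ge 1" for y
    using order_ge_mult[OF order_ge_0 var_in_order_ge] by simp
  then have "\<phi> (a * r z * (right_deriv y b * var y)) = 0" for y
    using extensions_kill[OF \<phi>] by blast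
  then have "\<phi> (a * r z * b') = 0"
    by (simp add: b'_def distrib_left functional_add[OF lin])
  moreover have "\<phi> (a * r z * const c) = 0"
  proof -
    have "\<phi> (a * r z) = 0" using zero[of z] by (simp add: contract_def fun_eq_iff)
    then show ?thesis
      by (simp add: functional_scale[OF lin] flip: const_commute)
  qed
  moreover have "b = const c + b'"
    unfolding b'_def c_def add.assoc[symmetric] by (rule right_decomposition)
  ultimately show "\<phi> (a * r z * b) = 0"
    by (simp add: distrib_left functional_add[OF lin])
qed

text \<open>By the syzygy, the sum evaluates the functional at elements in which a relation is followed by a
letter, and those are killed.\<close>

lemma contract_syzygy:
  assumes \<phi>: "\<phi> \<in> extensions n"
  shows "contract (var X) (contract (r X) \<phi>) + contract (var Y) (contract (r Y) \<phi>) = 0"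
proof
  fix q
  have lin: "\<phi> \<in> functionals" using \<phi> by (simp add: extensions_def)
  have "\<phi> (q * var X * r X) + \<phi> (q * var Y * r Y) = \<phi> (q * (var X * r X + var Y * r Y))"
    by (simp add: functional_add[OF lin] distrib_left mult.assoc)
  also have "\<dots> = \<phi> (q * r X * var X) + \<phi> (q * r Y * var Y)"
    by (simp add: syzygy functional_add[OF lin] distrib_left mult.assoc)
  also have "\<dots> = 0"
    by (simp add: extensions_kill[OF \<phi> var_in_order_ge])
  finally show "(contract (var X) (contract (r X) \<phi>) + contract (var Y) (contract (r Y) \<phi>)) q = 0 q"
    by (simp add: contract_def)
qed

text \<open>A functional killed by contraction with \<open>y\<close> is determined by its contraction with \<open>x\<close> and its value
at 1.\<close>

lemma dim_Y_torsion_le: "fs.dim (Y_torsion n) \<le> Suc (fs.dim (annihilator (n - 1)))"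
proof -
  let ?K = "{\<phi> \<in> Y_torsion n. contract (var X) \<phi> = 0}"
  have sub: "fs.subspace (Y_torsion n)"
    unfolding Y_torsion_def by (rule subspace_kernel_in[OF subspace_annihilator])
  have K: "finite_dimensional ?K \<and> fs.dim ?K \<le> length [1 :: 'k free_alg]"
  proof (rule dim_le_length_if_separated)
    show "fs.subspace ?K" by (rule subspace_kernel_in[OF sub])
  next
    fix \<phi> assume \<phi>: "\<phi> \<in> ?K" and 1: "\<forall>v\<in>set [1]. \<phi> v = 0"
    have lin: "\<phi> \<in> functionals" using \<phi> by (simp add: Y_torsion_def annihilator_iff)
    have "\<phi> (const c) = 0" for c
      using functional_scale[OF lin, of c 1] 1 by simp
    moreover have "\<phi> (q * var X) = 0" "\<phi> (q * var Y) = 0" for q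
      using \<phi> by (auto simp: Y_torsion_def contract_def fun_eq_iff)
    ultimately have "\<phi> (const c + q * var X + q' * var Y) = 0" for c q q'
      by (simp add: functional_add[OF lin])
    then show "\<phi> = 0"
      using right_decomposition by (metis (no_types) ext zero_fun_apply)
  qed
  have image: "contract (var X) ` Y_torsion n \<subseteq> annihilator (n - 1)"
    using annihilator_contract_var by (auto simp: Y_torsion_def)
  have "fs.dim (Y_torsion n) \<le> fs.dim ?K + fs.dim (contract (var X) ` Y_torsion n)"
    using dim_le_dim_kernel_plus_dim_image[OF linear_contract sub] K
      finite_dimensional_mono[OF finite_dimensional_annihilator image] by blast
  also have "fs.dim (contract (var X) ` Y_torsion n) \<le> fs.dim (annihilator (n - 1))"
    by (rule dim_mono_of_finite_dimensional[OF finite_dimensional_annihilator image])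
  finally show ?thesis using K by (simp only: list.size) linarith
qed

lemma dim_Y_torsion_0: "fs.dim (Y_torsion 0) = 0"
  using dim_mono_of_finite_dimensional[OF finite_dimensional_annihilator, of "Y_torsion 0" 0]
  by (simp add: Y_torsion_def dim_annihilator_0)

text \<open>\<open>annihilator (Suc n)\<close> is cut out of \<open>extensions n\<close> by the vanishing of both contractions with
relations. The first contraction costs at most the dimension of \<open>annihilator (n - 3)\<close>. Once it
vanishes, the syzygy forces the second one into the smaller space \<open>Y_torsion (n - 3)\<close>; without this
saving the recursion below would not force growth.\<close>

lemma dim_extensions_le:
  "fs.dim (extensions n)
    \<le> fs.dim (annihilator (Suc n)) + fs.dim (annihilator (n - 3)) + fs.dim (Y_torsion (n - 3))"
proof -
  let ?U = "{\<phi> \<in> extensions n. contract (r X) \<phi> = 0}"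
  let ?K = "{\<phi> \<in> ?U. contract (r Y) \<phi> = 0}"
  have sub: "fs.subspace ?U" by (rule subspace_kernel_in[OF subspace_extensions])
  have fin: "finite_dimensional ?U" "finite_dimensional ?K"
    by (rule finite_dimensional_mono[OF finite_dimensional_extensions[of n]]; auto)+
  have imX: "contract (r X) ` extensions n \<subseteq> annihilator (n - 3)"
    using extensions_contract_relation by blast
  have imY: "contract (r Y) ` ?U \<subseteq> Y_torsion (n - 3)"
  proof (rule image_subsetI)
    fix \<phi> assume \<phi>: "\<phi> \<in> ?U"
    then have "contract (var X) (contract (r X) \<phi>) = 0"
      by (simp add: contract_def fun_eq_iff)
    then have "contract (var Y) (contract (r Y) \<phi>) = 0"
      using contract_syzygy[of \<phi> n] \<phi> by simp
    then show "contract (r Y) \<phi> \<in> Y_torsion (n - 3)"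
      using extensions_contract_relation \<phi> by (simp add: Y_torsion_def)
  qed
  have "?K \<subseteq> annihilator (Suc n)"
  proof
    fix \<phi> assume "\<phi> \<in> ?K"
    moreover from this have "contract (r z) \<phi> = 0" for z by (cases z) auto
    ultimately show "\<phi> \<in> annihilator (Suc n)"
      using annihilator_if_contract_relations_eq_0 by blast
  qed
  then have "fs.dim ?K \<le> fs.dim (annihilator (Suc n))"
    by (rule dim_mono_of_finite_dimensional[OF finite_dimensional_annihilator])
  moreover have "fs.dim ?U \<le> fs.dim ?K + fs.dim (contract (r Y) ` ?U)"
    using dim_le_dim_kernel_plus_dim_image[OF linear_contract sub fin(2)]
      finite_dimensional_mono[OF finite_dimensional_Y_torsion imY] by blast
  moreover have "fs.dim (contract (r Y) ` ?U) \<le> fs.dim (Y_torsion (n - 3))"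
    by (rule dim_mono_of_finite_dimensional[OF finite_dimensional_Y_torsion imY])
  moreover have "fs.dim (extensions n) \<le> fs.dim ?U + fs.dim (contract (r X) ` extensions n)"
    using dim_le_dim_kernel_plus_dim_image[OF linear_contract subspace_extensions fin(1)]
      finite_dimensional_mono[OF finite_dimensional_annihilator imX] by blast
  moreover have "fs.dim (contract (r X) ` extensions n) \<le> fs.dim (annihilator (n - 3))"
    by (rule dim_mono_of_finite_dimensional[OF finite_dimensional_annihilator imX])
  ultimately show ?thesis by linarith
qed

text \<open>Composing with a right derivative inverts contraction by the corresponding letter.\<close>

lemma extension_with_one_contraction:
  assumes \<chi>: "\<chi> \<in> annihilator n"
  shows "\<exists>\<phi>\<in>extensions n. \<forall>y. contract (var y) \<phi> = (if y = z then \<chi> else 0)"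
proof
  let ?\<phi> = "\<lambda>q. \<chi> (right_deriv z q)"
  have lin: "\<chi> \<in> functionals" using \<chi> by (simp add: annihilator_iff)
  show contr: "\<forall>y. contract (var y) ?\<phi> = (if y = z then \<chi> else 0)"
    by (simp add: contract_def right_deriv_mult_var functional_0[OF lin] fun_eq_iff)
  have "?\<phi> \<in> functionals"
    using lin by (simp add: functionals_def right_deriv_add right_deriv_scale)
  then show "?\<phi> \<in> extensions n"
    using \<chi> fs.subspace_0[OF subspace_annihilator] by (simp add: extensions_def contr)
qed

text \<open>An element of \<open>extensions n\<close> amounts to a free choice of its two contractions by letters and of its
value at 1.\<close>

lemma dim_extensions_ge: "Suc (2 * fs.dim (annihilator n)) \<le> fs.dim (extensions n)"
proof -
  let ?U = "{\<phi> \<in> extensions n. contract (var X) \<phi> = 0}"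
  let ?K = "{\<phi> \<in> ?U. contract (var Y) \<phi> = 0}"
  have fin: "finite_dimensional ?U" "finite_dimensional ?K"
    by (rule finite_dimensional_mono[OF finite_dimensional_extensions[of n]]; auto)+
  have imX: "contract (var X) ` extensions n = annihilator n"
  proof
    show "annihilator n \<subseteq> contract (var X) ` extensions n"
    proof
      fix \<chi> assume "\<chi> \<in> annihilator n"
      then obtain \<phi> where "\<phi> \<in> extensions n"
        "\<forall>y. contract (var y) \<phi> = (if y = X then \<chi> else 0)"
        using extension_with_one_contraction by blast
      then show "\<chi> \<in> contract (var X) ` extensions n" by (metis image_eqI)
    qed
  qed (auto simp: extensions_def)
  have imY: "contract (var Y) ` ?U = annihilator n"
  proof
    show "annihilator n \<subseteq> contract (var Y) ` ?U"
    proof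
      fix \<chi> assume "\<chi> \<in> annihilator n"
      then obtain \<phi> where "\<phi> \<in> extensions n"
        "\<forall>y. contract (var y) \<phi> = (if y = Y then \<chi> else 0)"
        using extension_with_one_contraction by blast
      then have "\<phi> \<in> ?U" "\<chi> = contract (var Y) \<phi>" by simp_all
      then show "\<chi> \<in> contract (var Y) ` ?U" by blast
    qed
  qed (auto simp: extensions_def)
  have "1 \<le> fs.dim ?K"
  proof (rule dim_pos_of_finite_dimensional[OF fin(2)])
    \<comment> \<open>The functional extracting the constant term is killed by both contractions.\<close>
    let ?\<epsilon> = "\<lambda>q :: 'k free_alg. Poly_Mapping.lookup q 0"
    have "?\<epsilon> (q * var z) = 0" for q z
      using order_ge_mult[OF order_ge_0[of q] var_in_order_ge[of z]] by (simp add: lookup_0_of_order_ge)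
    then have contr: "contract (var z) ?\<epsilon> = 0" for z
      by (simp add: contract_def fun_eq_iff)
    moreover have "?\<epsilon> \<in> functionals"
      by (simp add: functionals_def lookup_add lookup_const_mult)
    ultimately show "?\<epsilon> \<in> ?K"
      using fs.subspace_0[OF subspace_annihilator] by (simp add: extensions_def)
    have "?\<epsilon> 1 \<noteq> 0" by (simp add: lookup_one)
    then show "?\<epsilon> \<noteq> 0" by (metis zero_fun_apply)
  qed
  moreover have "fs.dim ?K + fs.dim (annihilator n) \<le> fs.dim ?U"
    using dim_kernel_plus_dim_image_le[OF linear_contract[of "var Y"] fin(1)] unfolding imY .
  moreover have "fs.dim ?U + fs.dim (annihilator n) \<le> fs.dim (extensions n)"
    using dim_kernel_plus_dim_image_le[OF linear_contract[of "var X"] finite_dimensional_extensions[of n]]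
    unfolding imX .
  ultimately show ?thesis by linarith
qed

end

section \<open>Exponential growth\<close>

text \<open>The ratio \<open>8/5\<close> works because \<open>2 - (5/8)^3 - (5/8)^4 = 6567/4096\<close> is at least \<open>8/5\<close>. Up to \<open>n = 3\<close>
the truncated differences \<open>n - 3\<close> are zero, where both sequences vanish, and the recursion gives even
doubling.\<close>

lemma exponential_growth:
  fixes a t :: "nat \<Rightarrow> nat"
  assumes rec: "\<And>n. Suc (2 * a n) \<le> a (Suc n) + a (n - 3) + t (n - 3)"
    and a0: "a 0 = 0" and t0: "t 0 = 0" and t: "\<And>n. t n \<le> Suc (a (n - 1))"
  shows "8 * a n \<le> 5 * a (Suc n)"
proof (induction n rule: less_induct)
  case (less n)
  show ?case
  proof (cases "n \<le> 3")
    case True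
    then show ?thesis using rec[of n] a0 t0 by simp
  next
    case False
    define m where "m = n - 4"
    with False have m: "n = Suc (Suc (Suc (Suc m)))" by simp
    have "8 * a m \<le> 5 * a (Suc m)" "8 * a (Suc m) \<le> 5 * a (Suc (Suc m))"
      "8 * a (Suc (Suc m)) \<le> 5 * a (Suc (Suc (Suc m)))" "8 * a (Suc (Suc (Suc m))) \<le> 5 * a n"
      using less[of m] less[of "Suc m"] less[of "Suc (Suc m)"] less[of "Suc (Suc (Suc m))"]
      by (simp_all add: m)
    moreover have "2 * a n \<le> a (Suc n) + a (Suc m) + a m"
      using rec[of n] t[of "Suc m"] by (simp add: m)
    ultimately show ?thesis by linarith
  qed
qed

lemma (in potential_relations) dim_annihilator_ge: "n \<le> fs.dim (annihilator n)"
proof -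
  let ?a = "\<lambda>n. fs.dim (annihilator n)"
  have rec: "Suc (2 * ?a n) \<le> ?a (Suc n) + ?a (n - 3) + fs.dim (Y_torsion (n - 3))" for n
    using dim_extensions_ge dim_extensions_le by (rule le_trans)
  have growth: "8 * ?a n \<le> 5 * ?a (Suc n)" for n
    by (rule exponential_growth[OF rec dim_annihilator_0 dim_Y_torsion_0 dim_Y_torsion_le])
  show ?thesis
  proof (induction n)
    case (Suc n)
    then show ?case
      using growth[of n] rec[of 0] dim_annihilator_0 dim_Y_torsion_0 by (cases "n = 0") auto
  qed simp
qed

section \<open>Finite spanning sets of a potential algebra\<close>

lemma potential_ideal_killed:
  assumes \<phi>: "\<phi> \<in> functionals" and "\<And>a z b. \<phi> (a * left_deriv z F * b) = 0" and "p \<in> potential_ideal F"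
  shows "\<phi> p = 0"
proof -
  \<comment> \<open>The largest two-sided ideal contained in the kernel of \<open>\<phi>\<close>.\<close>
  let ?J = "{p. \<forall>a b. \<phi> (a * p * b) = 0}"
  have neg: "\<phi> (- q) = - \<phi> q" for q
    using functional_add[OF \<phi>, of q "- q"] functional_0[OF \<phi>] by (simp add: eq_neg_iff_add_eq_0 add.commute)
  have "ideal ?J (free_algebra :: 'a free_alg ring)"
  proof (rule idealI[OF ring_free_algebra])
    interpret ring "free_algebra :: 'a free_alg ring" by (rule ring_free_algebra)
    show "subgroup ?J (add_monoid (free_algebra :: 'a free_alg ring))"
    proof (rule add.subgroupI)
      show "?J \<noteq> {}" using functional_0[OF \<phi>] by (auto intro!: exI[of _ 0])
      fix p assume p: "p \<in> ?J"
      have "\<ominus>\<^bsub>free_algebra\<^esub> p = - p"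
        by (rule minus_equality) (simp_all add: free_algebra_def)
      then show "\<ominus>\<^bsub>free_algebra\<^esub> p \<in> ?J"
        using p by (simp add: neg)
    next
      fix p q assume "p \<in> ?J" "q \<in> ?J"
      then show "p \<oplus>\<^bsub>free_algebra\<^esub> q \<in> ?J"
        by (simp add: free_algebra_def distrib_left distrib_right functional_add[OF \<phi>])
    qed (simp add: free_algebra_def)
  next
    fix p q assume p: "p \<in> ?J"
    have "\<phi> (a * (q * p) * b) = \<phi> ((a * q) * p * b)" "\<phi> (a * (p * q) * b) = \<phi> (a * p * (q * b))" for a b
      by (simp_all add: mult.assoc)
    then show "q \<otimes>\<^bsub>free_algebra\<^esub> p \<in> ?J" "p \<otimes>\<^bsub>free_algebra\<^esub> q \<in> ?J"
      using p by (simp_all add: free_algebra_def)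
  qed
  then have "potential_ideal F \<subseteq> ?J"
    unfolding potential_ideal_def
    using assms(2) by (intro ring.genideal_minimal[OF ring_free_algebra]) auto
  then have "\<phi> (1 * p * 1) = 0" using assms(3) by blast
  then show ?thesis by simp
qed

text \<open>A spanning list of the quotient, lifted to the free algebra, detects the functionals that factor
through the quotient. Induction along the inductive definition of dimension produces the list
together with this property.\<close>

lemma separating_list_of_dimension:
  assumes "ring.dimension (potential_algebra F) n (scalars F) E"
  shows "\<exists>vs. length vs = n \<and>
    (\<forall>\<phi>\<in>functionals. (\<forall>p\<in>potential_ideal F. \<phi> p = 0) \<longrightarrow> (\<forall>v\<in>set vs. \<phi> v = 0) \<longrightarrow>
      (\<forall>C\<in>E. \<forall>p\<in>C. \<phi> p = 0))"
proof -
  interpret Q: ring "potential_algebra F" by (rule ring_potential_algebra)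
  note coset = a_r_coset_def' set_add_def' free_algebra_def
  show ?thesis using assms
  proof (induction n "scalars F" E rule: Q.dimension.induct)
    case zero_dim
    show ?case by (rule exI[of _ "[]"]) (simp add: potential_algebra_def FactRing_def)
  next
    case (Suc_dim v E n)
    obtain vs where vs: "length vs = n"
      "\<And>\<phi> C p. \<lbrakk>\<phi> \<in> functionals; \<forall>p\<in>potential_ideal F. \<phi> p = 0; \<forall>v\<in>set vs. \<phi> v = 0; C \<in> E; p \<in> C\<rbrakk>
        \<Longrightarrow> \<phi> p = 0"
      using Suc_dim.hyps(4) by blast
    obtain w where w: "v = potential_ideal F +>\<^bsub>free_algebra\<^esub> w"
      using Suc_dim.hyps(1) by (auto simp: potential_algebra_def FactRing_def A_RCOSETS_def')
    have "\<phi> p = 0"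
      if \<phi>: "\<phi> \<in> functionals" "\<forall>p\<in>potential_ideal F. \<phi> p = 0" "\<forall>v\<in>set (w # vs). \<phi> v = 0"
        and C: "C \<in> Q.line_extension (scalars F) v E" and p: "p \<in> C" for \<phi> C p
    proof -
      obtain k D where k: "k \<in> scalars F" and D: "D \<in> E"
        and C_eq: "C = (k \<otimes>\<^bsub>potential_algebra F\<^esub> v) \<oplus>\<^bsub>potential_algebra F\<^esub> D"
        using C by (auto simp: Q.line_extension_def set_add_def' r_coset_def)
      obtain c where c: "k = potential_ideal F +>\<^bsub>free_algebra\<^esub> const c"
        using k by (auto simp: scalars_def)
      have "k \<otimes>\<^bsub>potential_algebra F\<^esub> v = potential_ideal F +>\<^bsub>free_algebra\<^esub> (const c * w)"
        using ideal.rcoset_mult_add[OF ideal_potential_ideal, of "const c" w F]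
        by (simp add: potential_algebra_def FactRing_def c w) (simp add: free_algebra_def)
      then obtain i d where "p = (i + const c * w) + d" "i \<in> potential_ideal F" "d \<in> D"
        using p unfolding C_eq by (auto simp: potential_algebra_def FactRing_def coset)
      then show ?thesis
        using \<phi> vs(2)[of \<phi> D d] D by (simp add: functional_add functional_scale)
    qed
    note killed = this
    show ?case
    proof (intro exI[of _ "w # vs"] conjI ballI impI)
      show "length (w # vs) = Suc n" by (simp add: vs(1))
    qed (rule killed; assumption)
  qed
qed

theorem theorem1p1:
  fixes F :: "'k::field free_alg"
  assumes "cyclicly_invariant F"
    and "\<forall>m\<in>Poly_Mapping.keys F. length (letters m) \<ge> 5"
  shows "\<not> ring.finite_dimension (potential_algebra F) (scalars F) (carrier (potential_algebra F))"
proof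
  interpret Q: ring "potential_algebra F" by (rule ring_potential_algebra)
  have "F \<in> order_ge (Suc 4)" using assms(2) by (simp add: order_ge_def)
  then interpret potential_relations "\<lambda>z. left_deriv z F"
    by unfold_locales (simp_all add: left_deriv_order_ge potential_syzygy assms(1))
  assume "Q.finite_dimension (scalars F) (carrier (potential_algebra F))"
  then obtain n where "Q.dimension n (scalars F) (carrier (potential_algebra F))"
    unfolding Q.finite_dimension_def by blast
  then obtain vs where vs: "length vs = n"
    "\<And>\<phi> C p. \<lbrakk>\<phi> \<in> functionals; \<forall>p\<in>potential_ideal F. \<phi> p = 0; \<forall>v\<in>set vs. \<phi> v = 0;
      C \<in> carrier (potential_algebra F); p \<in> C\<rbrakk> \<Longrightarrow> \<phi> p = 0"
    using separating_list_of_dimension by blast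
  have "\<phi> = 0" if \<phi>: "\<phi> \<in> annihilator (Suc n)" and van: "\<forall>v\<in>set vs. \<phi> v = 0" for \<phi>
  proof
    fix p
    have "\<forall>p\<in>potential_ideal F. \<phi> p = 0"
      using potential_ideal_killed \<phi> by (auto simp: annihilator_iff)
    moreover have "potential_ideal F +>\<^bsub>free_algebra\<^esub> p \<in> carrier (potential_algebra F)"
      by (auto simp: potential_algebra_def FactRing_def A_RCOSETS_def' free_algebra_def)
    moreover have "p \<in> potential_ideal F +>\<^bsub>free_algebra\<^esub> p"
      using abelian_subgroup.a_rcos_self[OF abelian_subgroupI3, of "potential_ideal F" free_algebra p]
        ideal.axioms(1)[OF ideal_potential_ideal] ring.is_abelian_group[OF ring_free_algebra]
      by (auto simp: free_algebra_def)
    ultimately show "\<phi> p = 0 p" using vs(2) \<phi> van by (simp add: annihilator_iff)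
  qed
  then have "fs.dim (annihilator (Suc n)) \<le> length vs"
    using dim_le_length_if_separated[OF subspace_annihilator] by blast
  then show False using dim_annihilator_ge[of "Suc n"] vs(1) by simp
qed

end
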